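(* Let $d>0$ and let $\hat p_{ij}=(\hat x_{ij},\hat y_{ij})\in\mathbb{R}^2$ be the initial relative position of a pair of aircraft $(i,j)$ that are initially separated, i.e. $\hat x_{ij}^2+\hat y_{ij}^2\ge d^2$. For every relative velocity $v_{ij}=(v_{ij,x},v_{ij,y})\in\mathbb{R}^2$, with relative motion $p_{ij}(t)=\hat p_{ij}+t\,v_{ij}$, the trajectories are conflict-free, i.e. $\|p_{ij}(t)\|\ge d$ for all $t\ge 0$, if and only if there exists $z_{ij}\in\{0,1\}$ such that the following disjunctive linear conditions hold: $$\text{if } z_{ij}=1:\quad v_{ij,y}\hat x_{ij}-v_{ij,x}\hat y_{ij}\le 0 \ \text{ and }\ v_{ij,y}\gamma_{ij}^l-v_{ij,x}\phi_{ij}^l\le 0;$$ $$\text{if } z_{ij}=0:\quad v_{ij,y}\hat x_{ij}-v_{ij,x}\hat y_{ij}\ge 0 \ \text{ and }\ v_{ij,y}\gamma_{ij}^u-v_{ij,x}\phi_{ij}^u\ge 0.$$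
   Context: Two aircraft $i,j$ move in the plane with constant velocities $v_i,v_j\in\mathbb{R}^2$; $p_i(t)$, $p_j(t)$ are their positions, $p_{ij}(t)=p_i(t)-p_j(t)$, $\hat p_{ij}=p_{ij}(0)$ and $v_{ij}=v_i-v_j$. The number $d>0$ is the minimum separation distance and $\|\cdot\|$ is the Euclidean norm. Let $g_{ij}(v_x,v_y)=v_x^2(\hat y_{ij}^2-d^2)+v_y^2(\hat x_{ij}^2-d^2)-2\hat x_{ij}\hat y_{ij}v_xv_y$. Its zero set is the union of two lines through the origin (which coincide when $\|\hat p_{ij}\|=d$). The pairs $(\gamma_{ij}^l,\phi_{ij}^l)$ and $(\gamma_{ij}^u,\phi_{ij}^u)$ are coefficients of these two lines, written as $v_y\gamma-v_x\phi=0$, with signs chosen as follows. Put $s=\sqrt{\hat x_{ij}^2+\hat y_{ij}^2-d^2}$. Up to multiplication by positive scalars, $$(\gamma_{ij}^l,\phi_{ij}^l)=(\hat x_{ij}s-\hat y_{ij}d,\ \hat y_{ij}s+\hat x_{ij}d),\qquad (\gamma_{ij}^u,\phi_{ij}^u)=(\hat x_{ij}s+\hat y_{ij}d,\ \hat y_{ij}s-\hat x_{ij}d).$$ *)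

theory Defs
  imports "HOL-Analysis.Analysis"
begin

definition rel_pos :: "real^2 \<Rightarrow> real^2 \<Rightarrow> real \<Rightarrow> real^2" where
  "rel_pos p v t = p + t *\<^sub>R v"

definition conflict_free :: "real \<Rightarrow> real^2 \<Rightarrow> real^2 \<Rightarrow> bool" where
  "conflict_free d p v \<longleftrightarrow> (\<forall>t\<ge>0. norm (rel_pos p v t) \<ge> d)"

definition tangent_len :: "real \<Rightarrow> real^2 \<Rightarrow> real" where
  "tangent_len d p = sqrt ((p $ 1)\<^sup>2 + (p $ 2)\<^sup>2 - d\<^sup>2)"

(* The coefficients (gamma, phi) of a line v_y * gamma - v_x * phi = 0, with its sign fixed,
   are only determined up to a positive factor, so they are given by predicates. *)

definition lower_coeffs :: "real \<Rightarrow> real^2 \<Rightarrow> real \<Rightarrow> real \<Rightarrow> bool" where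
  "lower_coeffs d p \<gamma> \<phi> \<longleftrightarrow>
     (\<exists>c>0. \<gamma> = c * (p $ 1 * tangent_len d p - p $ 2 * d) \<and>
            \<phi> = c * (p $ 2 * tangent_len d p + p $ 1 * d))"

definition upper_coeffs :: "real \<Rightarrow> real^2 \<Rightarrow> real \<Rightarrow> real \<Rightarrow> bool" where
  "upper_coeffs d p \<gamma> \<phi> \<longleftrightarrow>
     (\<exists>c>0. \<gamma> = c * (p $ 1 * tangent_len d p + p $ 2 * d) \<and>
            \<phi> = c * (p $ 2 * tangent_len d p - p $ 1 * d))"

definition g :: "real \<Rightarrow> real^2 \<Rightarrow> real \<Rightarrow> real \<Rightarrow> real" where
  "g d p vx vy = vx\<^sup>2 * ((p $ 2)\<^sup>2 - d\<^sup>2) + vy\<^sup>2 * ((p $ 1)\<^sup>2 - d\<^sup>2) - 2 * p $ 1 * p $ 2 * vx * vy"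

lemma g_eq_0_iff:
  assumes d: "d > 0" and sep: "(p $ 1)\<^sup>2 + (p $ 2)\<^sup>2 \<ge> d\<^sup>2"
    and l: "lower_coeffs d p \<gamma>l \<phi>l" and u: "upper_coeffs d p \<gamma>u \<phi>u"
  shows "g d p vx vy = 0 \<longleftrightarrow> vy * \<gamma>l - vx * \<phi>l = 0 \<or> vy * \<gamma>u - vx * \<phi>u = 0"
proof -
  obtain a where a: "a > 0" "\<gamma>l = a * (p $ 1 * tangent_len d p - p $ 2 * d)"
      "\<phi>l = a * (p $ 2 * tangent_len d p + p $ 1 * d)"
    using l unfolding lower_coeffs_def by blast
  obtain b where b: "b > 0" "\<gamma>u = b * (p $ 1 * tangent_len d p + p $ 2 * d)"
      "\<phi>u = b * (p $ 2 * tangent_len d p - p $ 1 * d)"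
    using u unfolding upper_coeffs_def by blast
  have s: "(tangent_len d p)\<^sup>2 = (p $ 1)\<^sup>2 + (p $ 2)\<^sup>2 - d\<^sup>2"
    using sep by (simp add: tangent_len_def)
  have pos: "(p $ 1)\<^sup>2 + (p $ 2)\<^sup>2 > 0"
    using d sep zero_less_power[of d 2] by linarith
  have "(vy * \<gamma>l - vx * \<phi>l) * (vy * \<gamma>u - vx * \<phi>u) =
      a * b * ((p $ 1)\<^sup>2 + (p $ 2)\<^sup>2) * g d p vx vy"
    unfolding a b g_def using s by algebra
  then show ?thesis
    using a(1) b(1) pos by (metis less_irrefl mult_eq_0_iff)
qed

end

theory Submission
  imports Defs
begin

text \<open>
  Write \<open>D = p \<bullet> v\<close>, half the initial rate of change of the squared distance, \<open>C = p\<^sub>x v\<^sub>y - p\<^sub>y v\<^sub>x\<close> for the cross product and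
  \<open>s\<close> for the length of the tangent from \<open>p\<close> to the circle of radius \<open>d\<close> around the origin.
  Then \<open>\<parallel>p + t v\<parallel>\<^sup>2 - d\<^sup>2 = s\<^sup>2 + 2 t D + t\<^sup>2 \<parallel>v\<parallel>\<^sup>2\<close> is a quadratic in \<open>t\<close> that is nonnegative at
  \<open>0\<close>; it stays nonnegative for \<open>t \<ge> 0\<close> precisely if it does not decrease initially, \<open>D \<ge> 0\<close>,
  or its discriminant is not positive, \<open>D\<^sup>2 \<le> s\<^sup>2 \<parallel>v\<parallel>\<^sup>2\<close> (lemma \<open>quadratic_nonneg_on_nonneg_iff\<close>).

  Lagrange's identity \<open>(s\<^sup>2 + d\<^sup>2) \<parallel>v\<parallel>\<^sup>2 = \<parallel>p\<parallel>\<^sup>2 \<parallel>v\<parallel>\<^sup>2 = C\<^sup>2 + D\<^sup>2\<close> removes \<open>\<parallel>v\<parallel>\<close> from the discriminant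
  condition, which becomes \<open>(d D)\<^sup>2 \<le> (s C)\<^sup>2\<close>. The two alternatives together then say
  \<open>d D + s \<bar>C\<bar> \<ge> 0\<close> (lemma \<open>conflict_free_iff\<close>). This is linear in \<open>v\<close> once the sign of \<open>C\<close> is
  fixed, and that sign, the side on which the aircraft pass each other, is what \<open>z\<close> selects:
  up to a positive factor the lower form is \<open>s C - d D\<close> and the upper form is \<open>s C + d D\<close>.
\<close>

text \<open>
  If the slope \<open>2 * b\<close> at \<open>0\<close> is negative, the minimum lies at the positive time \<open>- b / c\<close>, with
  value \<open>a - b\<^sup>2 / c\<close>. The degenerate case \<open>c = 0\<close> is consistent: a decreasing affine function
  becomes negative, and \<open>b\<^sup>2 \<le> 0\<close> fails as well.
\<close>

lemma quadratic_nonneg_on_nonneg_iff: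
  fixes a b c :: real
  assumes a: "a \<ge> 0" and c: "c \<ge> 0"
  shows "(\<forall>t\<ge>0. a + 2 * t * b + t\<^sup>2 * c \<ge> 0) \<longleftrightarrow> b \<ge> 0 \<or> b\<^sup>2 \<le> a * c"
proof
  assume nonneg: "\<forall>t\<ge>0. a + 2 * t * b + t\<^sup>2 * c \<ge> 0"
  show "b \<ge> 0 \<or> b\<^sup>2 \<le> a * c"
  proof (rule disjCI)
    assume "\<not> b\<^sup>2 \<le> a * c"
    show "b \<ge> 0"
    proof (rule ccontr)
      assume b: "\<not> b \<ge> 0"
      show False
      proof (cases "c = 0")
        case True
        \<comment> \<open>At this time the affine function has the value \<open>- 1\<close>.\<close>
        have "(a + 1) / (- 2 * b) \<ge> 0"
          using a b by (intro divide_nonneg_nonneg) auto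
        from nonneg[rule_format, OF this] show False
          using True b by (simp add: field_simps)
      next
        case False
        have "- b / c \<ge> 0"
          using b c by (intro divide_nonneg_nonneg) auto
        from nonneg[rule_format, OF this] have "a - b\<^sup>2 / c \<ge> 0"
          using False by (simp add: power2_eq_square)
        then show False
          using False c \<open>\<not> b\<^sup>2 \<le> a * c\<close> by (simp add: field_simps)
      qed
    qed
  qed
next
  assume "b \<ge> 0 \<or> b\<^sup>2 \<le> a * c"
  then show "\<forall>t\<ge>0. a + 2 * t * b + t\<^sup>2 * c \<ge> 0"
  proof
    assume "b \<ge> 0"
    then show ?thesis
      using a c by simp
  next
    assume disc: "b\<^sup>2 \<le> a * c"
    show ?thesis
    proof (cases "c = 0")
      case True
      then show ?thesis
        using a disc by simp
    next
      case False
      \<comment> \<open>Completing the square.\<close>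
      have "c * (a + 2 * t * b + t\<^sup>2 * c) = (t * c + b)\<^sup>2 + (a * c - b\<^sup>2)" for t
        by algebra
      then have "c * (a + 2 * t * b + t\<^sup>2 * c) \<ge> 0" for t
        using disc by simp
      then show ?thesis
        using False c by (simp add: zero_le_mult_iff)
    qed
  qed
qed

lemma tangent_len_nonneg:
  assumes "(p $ 1)\<^sup>2 + (p $ 2)\<^sup>2 \<ge> d\<^sup>2"
  shows "tangent_len d p \<ge> 0"
  using assms by (simp add: tangent_len_def)

lemma tangent_len_squared:
  assumes "(p $ 1)\<^sup>2 + (p $ 2)\<^sup>2 \<ge> d\<^sup>2"
  shows "(tangent_len d p)\<^sup>2 = (p $ 1)\<^sup>2 + (p $ 2)\<^sup>2 - d\<^sup>2"
  using assms by (simp add: tangent_len_def)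

lemma conflict_free_iff_quadratic_nonneg:
  fixes p v :: "real^2"
  assumes d: "d \<ge> 0" and sep: "(p $ 1)\<^sup>2 + (p $ 2)\<^sup>2 \<ge> d\<^sup>2"
  shows "conflict_free d p v \<longleftrightarrow>
    (\<forall>t\<ge>0. (tangent_len d p)\<^sup>2 + 2 * t * (p $ 1 * v $ 1 + p $ 2 * v $ 2)
      + t\<^sup>2 * ((v $ 1)\<^sup>2 + (v $ 2)\<^sup>2) \<ge> 0)"
proof -
  have "norm (rel_pos p v t) \<ge> d \<longleftrightarrow>
      (tangent_len d p)\<^sup>2 + 2 * t * (p $ 1 * v $ 1 + p $ 2 * v $ 2)
      + t\<^sup>2 * ((v $ 1)\<^sup>2 + (v $ 2)\<^sup>2) \<ge> 0" for t
  proof -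
    have "(norm (rel_pos p v t))\<^sup>2 = (p $ 1 + t * v $ 1)\<^sup>2 + (p $ 2 + t * v $ 2)\<^sup>2"
      unfolding power2_norm_eq_inner
      by (simp add: rel_pos_def inner_vec_def sum_2 power2_eq_square)
    also have "\<dots> - d\<^sup>2 = (tangent_len d p)\<^sup>2 + 2 * t * (p $ 1 * v $ 1 + p $ 2 * v $ 2)
        + t\<^sup>2 * ((v $ 1)\<^sup>2 + (v $ 2)\<^sup>2)"
      unfolding tangent_len_squared[OF sep] by algebra
    finally have excess: "(norm (rel_pos p v t))\<^sup>2 - d\<^sup>2 = \<dots>" .
    have "norm (rel_pos p v t) \<ge> d \<longleftrightarrow> (norm (rel_pos p v t))\<^sup>2 - d\<^sup>2 \<ge> 0"
      using d by (simp add: power_mono_iff)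
    then show ?thesis
      unfolding excess .
  qed
  then show ?thesis
    by (simp add: conflict_free_def)
qed

text \<open>
  The ratio of \<open>d\<close> to the tangent length is the tangent of the half-angle under which the circle
  of radius \<open>d\<close> is seen from \<open>p\<close> (a right angle if \<open>p\<close> lies on it), so the inequality says that \<open>v\<close> does not point into the open cone from \<open>p\<close>
  around the circle.
\<close>

lemma conflict_free_iff:
  fixes p v :: "real^2"
  assumes d: "d > 0" and sep: "(p $ 1)\<^sup>2 + (p $ 2)\<^sup>2 \<ge> d\<^sup>2"
  shows "conflict_free d p v \<longleftrightarrow>
    d * (p $ 1 * v $ 1 + p $ 2 * v $ 2) + tangent_len d p * \<bar>v $ 2 * p $ 1 - v $ 1 * p $ 2\<bar> \<ge> 0"
proof -
  define D where "D = p $ 1 * v $ 1 + p $ 2 * v $ 2"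
  define C where "C = v $ 2 * p $ 1 - v $ 1 * p $ 2"
  define V where "V = (v $ 1)\<^sup>2 + (v $ 2)\<^sup>2"
  define s where "s = tangent_len d p"
  have s: "s \<ge> 0" "s\<^sup>2 = (p $ 1)\<^sup>2 + (p $ 2)\<^sup>2 - d\<^sup>2"
    unfolding s_def using sep by (rule tangent_len_nonneg, rule tangent_len_squared)
  have norm_pos: "s\<^sup>2 + d\<^sup>2 > 0"
    using d by (simp add: add_nonneg_pos)
  have lagrange: "(s\<^sup>2 + d\<^sup>2) * V = C\<^sup>2 + D\<^sup>2"
    unfolding C_def D_def V_def s(2) by algebra
  have "conflict_free d p v \<longleftrightarrow> D \<ge> 0 \<or> D\<^sup>2 \<le> s\<^sup>2 * V"
    using conflict_free_iff_quadratic_nonneg[OF less_imp_le[OF d] sep, of v]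
      quadratic_nonneg_on_nonneg_iff[of "s\<^sup>2" V D]
    by (simp add: D_def V_def s_def)
  also have "D\<^sup>2 \<le> s\<^sup>2 * V \<longleftrightarrow> (d * D)\<^sup>2 \<le> (s * C)\<^sup>2"
  proof -
    have "(s\<^sup>2 + d\<^sup>2) * (s\<^sup>2 * V - D\<^sup>2) = (s * C)\<^sup>2 - (d * D)\<^sup>2"
      using lagrange by algebra
    then show ?thesis
      using norm_pos by (smt (verit) zero_le_mult_iff)
  qed
  also have "(d * D)\<^sup>2 \<le> (s * C)\<^sup>2 \<longleftrightarrow> d * \<bar>D\<bar> \<le> s * \<bar>C\<bar>"
    using d s(1) by (simp add: abs_le_square_iff[symmetric] abs_mult)
  also have "D \<ge> 0 \<or> d * \<bar>D\<bar> \<le> s * \<bar>C\<bar> \<longleftrightarrow> d * D + s * \<bar>C\<bar> \<ge> 0"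
    using d s(1) by (cases "D \<ge> 0") auto
  finally show ?thesis
    by (simp add: D_def C_def s_def)
qed

lemma lower_form_nonpos_iff:
  assumes "lower_coeffs d p \<gamma> \<phi>"
  shows "vy * \<gamma> - vx * \<phi> \<le> 0 \<longleftrightarrow>
    tangent_len d p * (vy * p $ 1 - vx * p $ 2) \<le> d * (p $ 1 * vx + p $ 2 * vy)"
proof -
  obtain c where c: "c > 0" "\<gamma> = c * (p $ 1 * tangent_len d p - p $ 2 * d)"
      "\<phi> = c * (p $ 2 * tangent_len d p + p $ 1 * d)"
    using assms unfolding lower_coeffs_def by blast
  have "vy * \<gamma> - vx * \<phi> =
      c * (tangent_len d p * (vy * p $ 1 - vx * p $ 2) - d * (p $ 1 * vx + p $ 2 * vy))"
    unfolding c by algebra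
  then show ?thesis
    using c(1) by (simp add: mult_le_0_iff)
qed

lemma upper_form_nonneg_iff:
  assumes "upper_coeffs d p \<gamma> \<phi>"
  shows "vy * \<gamma> - vx * \<phi> \<ge> 0 \<longleftrightarrow>
    d * (p $ 1 * vx + p $ 2 * vy) + tangent_len d p * (vy * p $ 1 - vx * p $ 2) \<ge> 0"
proof -
  obtain c where c: "c > 0" "\<gamma> = c * (p $ 1 * tangent_len d p + p $ 2 * d)"
      "\<phi> = c * (p $ 2 * tangent_len d p - p $ 1 * d)"
    using assms unfolding upper_coeffs_def by blast
  have "vy * \<gamma> - vx * \<phi> =
      c * (d * (p $ 1 * vx + p $ 2 * vy) + tangent_len d p * (vy * p $ 1 - vx * p $ 2))"
    unfolding c by algebra
  then show ?thesis
    using c(1) by (simp add: zero_le_mult_iff)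
qed

theorem theorem1:
  fixes d :: real and p v :: "real^2" and \<gamma>l \<phi>l \<gamma>u \<phi>u :: real
  assumes "d > 0"
    and "(p $ 1)\<^sup>2 + (p $ 2)\<^sup>2 \<ge> d\<^sup>2"
    and "lower_coeffs d p \<gamma>l \<phi>l"
    and "upper_coeffs d p \<gamma>u \<phi>u"
  shows "conflict_free d p v \<longleftrightarrow>
    (\<exists>z\<in>{0, 1 :: nat}.
      (z = 1 \<longrightarrow> v $ 2 * p $ 1 - v $ 1 * p $ 2 \<le> 0 \<and> v $ 2 * \<gamma>l - v $ 1 * \<phi>l \<le> 0) \<and>
      (z = 0 \<longrightarrow> v $ 2 * p $ 1 - v $ 1 * p $ 2 \<ge> 0 \<and> v $ 2 * \<gamma>u - v $ 1 * \<phi>u \<ge> 0))"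
proof -
  define D where "D = p $ 1 * v $ 1 + p $ 2 * v $ 2"
  define C where "C = v $ 2 * p $ 1 - v $ 1 * p $ 2"
  define s where "s = tangent_len d p"
  have "conflict_free d p v \<longleftrightarrow> d * D + s * \<bar>C\<bar> \<ge> 0"
    unfolding D_def C_def s_def using assms(1,2) by (rule conflict_free_iff)
  also have "\<dots> \<longleftrightarrow> (C \<le> 0 \<and> s * C \<le> d * D) \<or> (C \<ge> 0 \<and> d * D + s * C \<ge> 0)"
    by (cases "C \<ge> 0") auto
  finally show ?thesis
    unfolding lower_form_nonpos_iff[OF assms(3)] upper_form_nonneg_iff[OF assms(4)]
    by (auto simp: D_def C_def s_def)
qed

end
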